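(* Let $N\ge 1$, let $r^1,\dots,r^N:\mathbb{R}\to\mathbb{R}$ be strictly concave, and let $\beta_k\ge0$ for all $k$. Let $\Gamma_1\subseteq\mathbb{R}^N$ be the set obtained from $r^1,\dots,r^N$ and $\beta_1,\dots,\beta_{N-1}$ by the recursion in the context. Then $\Gamma_1$ is parameterized by a homeomorphism $\psi_1:\mathbb{R}\to\Gamma_1$.
   Context: **Envelopes.** Let $f:\mathbb{R}^m\to\mathbb{R}^n$. A function $g:\mathbb{R}^m\to\mathbb{R}$ is $f$-concave if $g=\phi\circ f$ for some concave $\phi:\mathbb{R}^n\to\mathbb{R}$. For $\Gamma\subseteq\mathbb{R}^m$, $\hat g$ is the $(f,\Gamma)$-concave envelope of $g$ if $\hat g$ is $f$-concave, $\hat g\ge g$ on $\Gamma$, and every $f$-concave $\tilde g$ with $\tilde g\ge g$ on $\Gamma$ satisfies $\tilde g\ge\hat g$ on $\Gamma$. It is constructed as $\hat g=\hat\phi\circ f$, where $\hat\phi$ is the concave envelope (least concave majorant) of $\phi(y):=\sup\{g(x):x\in\Gamma,\ f(x)=y\}$ (with $\phi(y)=-\infty$ if there is no such $x$). The corresponding touching set is $\{x\in\Gamma:g(x)=\hat g(x)\}$. **Recursion.** For $1\le k\le N$ put $\mu_k(a_k,\dots,a_N):=\sum_{j=k}^N\gamma_{k,j}r^j(a_j)$, where $\gamma_{k,k}:=1$ and $\gamma_{k,j}:=\prod_{\ell=k}^{j-1}\beta_\ell$ for $j>k$. Let $\hat\phi_N$ be the concave envelope of $r^N$ and $\Gamma_N:=\{a\in\mathbb{R}:r^N(a)=\hat\phi_N(a)\}$.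 For $k=N-1,\dots,1$, with $f_k(a_k,\dots,a_N):=a_k+\cdots+a_N$, let $\Gamma_k\subseteq\mathbb{R}^{N-k+1}$ be the touching set corresponding to the $(f_k,\mathbb{R}\times\Gamma_{k+1})$-concave envelope of $\mu_k$. Here $r^k$ is the running utility of effort of Player $k$ in a hierarchy of Players $0,\dots,N$, and $-\beta_k r$ is Player $k$'s utility from paying $r$ to Player $k+1$. $\Gamma_1$ carries the subspace topology of $\mathbb{R}^N$.
   Formalization: The formal theorem additionally assumes that Γ_1 is nonempty; without this the claim fails, e.g. for N=2, β_1=1, r^1(x)=-e^x, r^2(x)=-e^{-x}, where the envelope is the constant 0 and is never touched, so Γ_1 is empty. *)

theory Defs
  imports "HOL-Analysis.Analysis"
begin

definition strictly_concave :: "(real \<Rightarrow> real) \<Rightarrow> bool" where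
  "strictly_concave r \<longleftrightarrow>
     (\<forall>x y t. x \<noteq> y \<and> 0 < t \<and> t < 1 \<longrightarrow>
        (1 - t) * r x + t * r y < r ((1 - t) * x + t * y))"

text \<open>In the next three definitions the carrier \<open>D\<close> plays the role of the domain space
  $R^m$ of \<open>f\<close>, so that the dimension may vary along the recursion below.\<close>

definition f_concave :: "'a set \<Rightarrow> ('a \<Rightarrow> 'b::euclidean_space) \<Rightarrow> ('a \<Rightarrow> real) \<Rightarrow> bool" where
  "f_concave D f g \<longleftrightarrow> (\<exists>\<phi>. concave_on UNIV \<phi> \<and> (\<forall>x\<in>D. g x = \<phi> (f x)))"

definition is_f_concave_envelope ::
  "'a set \<Rightarrow> ('a \<Rightarrow> 'b::euclidean_space) \<Rightarrow> 'a set \<Rightarrow> ('a \<Rightarrow> real) \<Rightarrow> ('a \<Rightarrow> real) \<Rightarrow> bool" where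
  "is_f_concave_envelope D f \<Gamma> g h \<longleftrightarrow>
     f_concave D f h \<and> (\<forall>x\<in>\<Gamma>. g x \<le> h x) \<and>
     (\<forall>h'. f_concave D f h' \<and> (\<forall>x\<in>\<Gamma>. g x \<le> h' x) \<longrightarrow> (\<forall>x\<in>\<Gamma>. h x \<le> h' x))"

text \<open>By minimality, any two \<open>(f, \<Gamma>)\<close>-concave envelopes of \<open>g\<close> agree on \<open>\<Gamma>\<close>, so the choice of
  \<open>h\<close> is immaterial here. If there is no envelope (no \<open>f\<close>-concave function dominates \<open>g\<close> on
  \<open>\<Gamma>\<close>), the touching set is empty.\<close>

definition touching_set ::
  "'a set \<Rightarrow> ('a \<Rightarrow> 'b::euclidean_space) \<Rightarrow> 'a set \<Rightarrow> ('a \<Rightarrow> real) \<Rightarrow> 'a set" where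
  "touching_set D f \<Gamma> g = {x \<in> \<Gamma>. \<exists>h. is_f_concave_envelope D f \<Gamma> g h \<and> g x = h x}"

definition is_concave_envelope :: "('b::euclidean_space \<Rightarrow> real) \<Rightarrow> ('b \<Rightarrow> real) \<Rightarrow> bool" where
  "is_concave_envelope \<phi> h \<longleftrightarrow>
     concave_on UNIV h \<and> (\<forall>y. \<phi> y \<le> h y) \<and>
     (\<forall>h'. concave_on UNIV h' \<and> (\<forall>y. \<phi> y \<le> h' y) \<longrightarrow> (\<forall>y. h y \<le> h' y))"

text \<open>A point $(a_k, \ldots, a_N)$ of $R^{N-k+1}$ is an extensional function on the index set
  \<open>{k..N}\<close>, i.e. a point of the topological space \<open>powertop_real {k..N}\<close>.\<close>

abbreviation effort_space :: "nat \<Rightarrow> nat \<Rightarrow> (nat \<Rightarrow> real) set" where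
  "effort_space k N \<equiv> PiE {k..N} (\<lambda>_. UNIV)"

definition gamma_coeff :: "(nat \<Rightarrow> real) \<Rightarrow> nat \<Rightarrow> nat \<Rightarrow> real" where
  "gamma_coeff \<beta> k j = (\<Prod>l\<in>{k..<j}. \<beta> l)"

definition mu ::
  "(nat \<Rightarrow> real \<Rightarrow> real) \<Rightarrow> (nat \<Rightarrow> real) \<Rightarrow> nat \<Rightarrow> nat \<Rightarrow> (nat \<Rightarrow> real) \<Rightarrow> real" where
  "mu r \<beta> N k a = (\<Sum>j=k..N. gamma_coeff \<beta> k j * r j (a j))"

text \<open>Backward recursion from \<open>k = N\<close> down to \<open>k = 1\<close>; indices \<open>k > N\<close> are never reached. In
  the recursive case the middle argument of \<open>touching_set\<close> is $R \times \Gamma_{k+1}$. The set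
  can be empty, since the suprema behind the envelopes need not be finite or attained: for
  $N = 2$, $\beta_1 = 1$, $r^1(x) = -e^x$ and $r^2(x) = -e^{-x}$ the envelope of \<open>mu\<close> at \<open>k = 1\<close>
  is the constant \<open>0\<close> and is touched nowhere.\<close>

function Gam :: "(nat \<Rightarrow> real \<Rightarrow> real) \<Rightarrow> (nat \<Rightarrow> real) \<Rightarrow> nat \<Rightarrow> nat \<Rightarrow> (nat \<Rightarrow> real) set" where
  "Gam r \<beta> N k =
     (if k < N
      then touching_set (effort_space k N) (\<lambda>a. \<Sum>j=k..N. a j)
             {a \<in> effort_space k N. restrict a {Suc k..N} \<in> Gam r \<beta> N (Suc k)}
             (mu r \<beta> N k)
      else {a \<in> effort_space N N. \<exists>h. is_concave_envelope (r N) h \<and> r N (a N) = h (a N)})"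
  by pat_completeness auto
termination by (relation "Wellfounded.measure (\<lambda>(r, \<beta>, N, k). N - k)") auto

declare Gam.simps [simp del]

end

theory Submission
  imports Defs
begin

text \<open>
  By induction downwards on \<open>k\<close>, the total effort \<open>a\<^sub>k + \<dots> + a\<^sub>N\<close> is a global coordinate on
  a nonempty \<open>\<Gamma>\<^sub>k\<close>: every real \<open>y\<close> is the total of exactly one point \<open>x y\<close> of \<open>\<Gamma>\<^sub>k\<close>. The induction also
  carries the facts that the components of \<open>x y\<close> are monotone in \<open>y\<close> and that
  \<open>\<lambda>y. \<mu>\<^sub>k (x y)\<close> is concave (predicate \<open>total_effort_parameterization\<close>). Monotone components
  with sum \<open>y\<close> are 1-Lipschitz, so \<open>x\<close> is continuous, and its inverse, summation, is
  continuous too. Hence \<open>x\<close> is a homeomorphism.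

  In the induction step, a point of \<open>\<real> \<times> \<Gamma>\<^sub>k\<^sub>+\<^sub>1\<close> is an effort \<open>a\<close> followed by \<open>x s\<close> for some
  total \<open>s\<close>. There \<open>\<mu>\<^sub>k\<close> is \<open>r\<^sup>k a + \<phi> s\<close> with \<open>\<phi> s = \<beta>\<^sub>k \<mu>\<^sub>k\<^sub>+\<^sub>1 (x s)\<close> concave, and the sum
  is \<open>a + s\<close>. So the envelope is governed by the sup-convolution of \<open>r\<^sup>k\<close> and \<open>\<phi>\<close>, the
  maximum of \<open>r\<^sup>k (y - s) + \<phi> s\<close> over \<open>s\<close>. The only difficulty is whether this maximum is
  attained, and a single point of \<open>\<Gamma>\<^sub>k\<close> settles it for all \<open>y\<close> at once. A supporting line of
  the envelope at a touching point \<open>(a\<^sub>0, s\<^sub>0)\<close>, of slope \<open>p\<close>, splits into supporting lines of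
  \<open>r\<^sup>k\<close> at \<open>a\<^sub>0\<close> and of \<open>\<phi>\<close> at \<open>s\<^sub>0\<close>, both of slope \<open>p\<close>. Since \<open>r\<^sup>k\<close> is strictly concave it
  falls below its line at a linear rate, so the maximization is coercive
  (\<open>convolution_attained\<close>). Strict concavity makes the maximizer unique, an exchange argument
  makes it monotone in \<open>y\<close>, and the maximum is concave in \<open>y\<close>. Being concave and attained
  everywhere, it is the envelope, and it is touched exactly at the maximizers.
\<close>

section \<open>Concave functions on the line\<close>

lemma strictly_concave_imp_concave_on:
  assumes "strictly_concave r"
  shows "concave_on UNIV r"
proof -
  have "(1 - t) * r x + t * r y \<le> r ((1 - t) * x + t * y)"
    if "0 < t" "t < 1" "x \<noteq> y" for t x y :: real
    using assms that unfolding strictly_concave_def by (meson less_imp_le)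
  then have "(1 - t) * r x + t * r y \<le> r ((1 - t) * x + t * y)"
    if "0 < t" "t < 1" for t x y :: real
    using that by (cases "x = y") (auto simp: algebra_simps)
  then have "convex_on UNIV (\<lambda>x. - r x)"
    by (intro convex_onI) (auto simp: algebra_simps)
  then show ?thesis by (simp add: concave_on_def)
qed

lemma strictly_concave_midpoint:
  assumes "strictly_concave r" "x \<noteq> y"
  shows "(r x + r y) / 2 < r ((x + y) / 2)"
proof -
  have "(0::real) < 1/2" "(1/2::real) < 1" by auto
  then have "(1 - 1/2) * r x + 1/2 * r y < r ((1 - 1/2) * x + 1/2 * y)"
    using assms unfolding strictly_concave_def by blast
  moreover have "(1 - 1/2) * u + 1/2 * v = (u + v) / 2" for u v :: real
    by (simp add: field_simps)
  ultimately show ?thesis by (simp only:)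
qed

lemma concave_onD_real:
  fixes f :: "real \<Rightarrow> real"
  assumes "concave_on UNIV f" "0 \<le> t" "t \<le> 1"
  shows "(1 - t) * f x + t * f y \<le> f ((1 - t) * x + t * y)"
  using convex_onD[of UNIV "\<lambda>x. - f x" t x y] assms
  by (auto simp: concave_on_def algebra_simps)

lemma concave_supporting_line:
  fixes f :: "real \<Rightarrow> real"
  assumes "concave_on UNIV f"
  obtains p where "\<And>y. f y \<le> f x + p * (y - x)"
proof -
  define q where "q = Inf ((\<lambda>t. (- f x - - f t) / (x - t)) ` ({x<..} \<inter> UNIV))"
  have "- f y \<ge> - f x + q * (y - x)" for y
    unfolding q_def using assms
    by (intro convex_le_Inf_differential) (auto simp: concave_on_def)
  then have "f y \<le> f x + (- q) * (y - x)" for y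
    by (metis (no_types, opaque_lifting) add.inverse_inverse minus_add_distrib mult_minus_left neg_le_iff_le)
  then show thesis by (rule that)
qed

lemma concave_continuous_on:
  fixes f :: "real \<Rightarrow> real"
  assumes "concave_on UNIV f"
  shows "continuous_on UNIV f"
  using convex_on_continuous[of UNIV "\<lambda>x. - f x"] assms continuous_on_minus[of UNIV "\<lambda>x. - f x"]
  by (simp add: concave_on_def)

text \<open>Both \<open>v\<close> and \<open>v'\<close> are convex combinations of \<open>u\<close> and \<open>w\<close>, with complementary weights.\<close>

lemma concave_exchange:
  fixes f :: "real \<Rightarrow> real"
  assumes f: "concave_on UNIV f" and "u \<le> v" "v \<le> w" "u + w = v + v'"
  shows "f u + f w \<le> f v + f v'"
proof (cases "u = w")
  case False
  define t where "t = (v - u) / (w - u)"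
  have t: "0 \<le> t" "t \<le> 1" and tw: "t * (w - u) = v - u"
    using assms False by (auto simp: t_def divide_simps)
  have v: "(1 - t) * u + t * w = v" using tw by (simp add: algebra_simps)
  have v': "(1 - t) * w + t * u = v'" using tw assms(4) by (simp add: algebra_simps)
  have "(1 - t) * f u + t * f w \<le> f v" using concave_onD_real[OF f t, of u w] v by simp
  moreover have "(1 - t) * f w + t * f u \<le> f v'"
    using concave_onD_real[OF f t, of w u] v' by simp
  moreover have "(1 - t) * f u + t * f w + ((1 - t) * f w + t * f u) = f u + f w"
    by (simp add: algebra_simps)
  ultimately show ?thesis by linarith
qed (use assms in auto)

text \<open>The gap to a supporting line is zero at the contact point and positive at distance 1 from
  it; by concavity it grows at least linearly from there on.\<close>

lemma strictly_concave_linear_decay: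
  assumes r: "strictly_concave r" and line: "\<And>x. r x \<le> r x0 + p * (x - x0)"
  obtains c where "c > 0"
    "\<And>x. \<bar>x - x0\<bar> \<ge> 1 \<Longrightarrow> r x \<le> r x0 + p * (x - x0) - c * \<bar>x - x0\<bar>"
proof -
  define d where "d x = r x0 + p * (x - x0) - r x" for x
  have d_pos: "d x > 0" if "x \<noteq> x0" for x
  proof -
    have "(r x0 + r x) / 2 < r ((x0 + x) / 2)"
      using that by (intro strictly_concave_midpoint[OF r]) simp
    also have "\<dots> \<le> r x0 + p * ((x0 + x) / 2 - x0)" by (rule line)
    finally show ?thesis by (simp add: d_def field_simps)
  qed
  define c where "c = min (d (x0 - 1)) (d (x0 + 1))"
  have c: "c > 0" using d_pos by (simp add: c_def)
  have "c * \<bar>x - x0\<bar> \<le> d x" if "\<bar>x - x0\<bar> \<ge> 1" for x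
  proof -
    define D where "D = \<bar>x - x0\<bar>"
    define e where "e = (x - x0) / D"
    have D: "D \<ge> 1" and x: "D * e = x - x0" using that by (auto simp: D_def e_def)
    have "e = 1 \<or> e = -1" using that by (auto simp: e_def D_def abs_if divide_eq_eq)
    then have ce: "c \<le> d (x0 + e)" by (auto simp: c_def)
    have mid: "(1 - 1/D) * x0 + 1/D * x = x0 + e"
      using D by (simp add: e_def field_simps)
    have "(1 - 1/D) * r x0 + 1/D * r x \<le> r (x0 + e)"
      using concave_onD_real[OF strictly_concave_imp_concave_on[OF r], of "1/D" x0 x] D mid
      by simp
    then have "D * ((1 - 1/D) * r x0 + 1/D * r x) \<le> D * r (x0 + e)"
      using D by (intro mult_left_mono) auto
    moreover have "D * ((1 - 1/D) * r x0 + 1/D * r x) = (D - 1) * r x0 + r x"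
      using D by (simp add: field_simps)
    moreover have "D * d (x0 + e) = D * r x0 + p * (x - x0) - D * r (x0 + e)"
      unfolding d_def x[symmetric] by (simp add: algebra_simps)
    ultimately have "D * d (x0 + e) \<le> d x"
      by (simp add: d_def left_diff_distrib)
    moreover have "D * c \<le> D * d (x0 + e)" using ce D by (intro mult_left_mono) auto
    ultimately show ?thesis by (simp add: D_def mult.commute)
  qed
  with c show thesis by (intro that[of c]) (auto simp: d_def algebra_simps)
qed

section \<open>Sup-convolution with a strictly concave function\<close>

text \<open>The two supporting lines bound the objective from above by an affine function of \<open>y\<close>
  minus a gap that grows linearly with \<open>\<bar>y - t - a\<^sub>0\<bar>\<close>. So only \<open>t\<close> in a compact interval can
  compete with the candidate \<open>t = s\<^sub>0\<close>.\<close>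

lemma convolution_attained:
  assumes r: "strictly_concave r" and \<phi>: "concave_on UNIV \<phi>"
    and line_r: "\<And>a. r a \<le> r a0 + p * (a - a0)"
    and line_\<phi>: "\<And>s. \<phi> s \<le> \<phi> s0 + p * (s - s0)"
  shows "\<exists>s. \<forall>t. r (y - t) + \<phi> t \<le> r (y - s) + \<phi> s"
proof -
  define F where "F t = r (y - t) + \<phi> t" for t
  obtain c where c: "c > 0"
    "\<And>a. \<bar>a - a0\<bar> \<ge> 1 \<Longrightarrow> r a \<le> r a0 + p * (a - a0) - c * \<bar>a - a0\<bar>"
    using strictly_concave_linear_decay[OF r line_r] by blast
  \<comment> \<open>The upper bound for \<open>F\<close>, which depends on \<open>t\<close> only through the gap.\<close>
  define M where "M = r a0 + \<phi> s0 + p * (y - a0 - s0)"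
  define R where "R = 1 + \<bar>y - a0 - s0\<bar> + \<bar>M - F s0\<bar> / c"
  have R: "R \<ge> 1" "R \<ge> \<bar>y - a0 - s0\<bar>" "R \<ge> \<bar>M - F s0\<bar> / c"
    using c by (auto simp: R_def)
  have "continuous_on UNIV (\<lambda>t. r (y - t))"
    by (rule continuous_on_compose2[OF
          concave_continuous_on[OF strictly_concave_imp_concave_on[OF r]]])
      (auto intro: continuous_on_diff continuous_on_const continuous_on_id)
  then have "continuous_on UNIV F"
    unfolding F_def using concave_continuous_on[OF \<phi>] by (rule continuous_on_add)
  then have "continuous_on (cball (y - a0) R) F"
    by (rule continuous_on_subset) simp
  then obtain s where s: "s \<in> cball (y - a0) R" "\<And>t. t \<in> cball (y - a0) R \<Longrightarrow> F t \<le> F s"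
    using continuous_attains_sup[of "cball (y - a0) R" F] R by auto
  have s0: "F s0 \<le> F s" using R by (intro s) (simp add: dist_real_def)
  have "F t \<le> F s" for t
  proof (cases "t \<in> cball (y - a0) R")
    case False
    then have far: "\<bar>y - t - a0\<bar> > R" by (simp add: dist_real_def algebra_simps)
    have "c * (\<bar>M - F s0\<bar> / c) \<le> c * \<bar>y - t - a0\<bar>"
      using far R c by (intro mult_left_mono) auto
    then have "M - F s0 \<le> c * \<bar>y - t - a0\<bar>" using c by simp
    moreover have "F t \<le> M - c * \<bar>y - t - a0\<bar>"
      using c(2)[of "y - t"] line_\<phi>[of t] far R by (simp add: F_def M_def algebra_simps)
    ultimately show ?thesis using s0 by linarith
  qed (use s in auto)
  then show ?thesis unfolding F_def by blast
qed

lemma convolution_maximizer_unique: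
  assumes r: "strictly_concave r" and \<phi>: "concave_on UNIV \<phi>"
    and max: "\<And>t. r (y - t) + \<phi> t \<le> r (y - s) + \<phi> s" and "t \<noteq> s"
  shows "r (y - t) + \<phi> t < r (y - s) + \<phi> s"
proof -
  have "(r (y - s) + r (y - t)) / 2 < r ((y - s + (y - t)) / 2)"
    using \<open>t \<noteq> s\<close> by (intro strictly_concave_midpoint[OF r]) simp
  also have "(y - s + (y - t)) / 2 = y - (s + t) / 2" by argo
  finally have "(r (y - s) + r (y - t)) / 2 < r (y - (s + t) / 2)" .
  moreover have "(\<phi> s + \<phi> t) / 2 \<le> \<phi> ((s + t) / 2)"
    using concave_onD_real[OF \<phi>, of "1/2" s t] by (simp add: add_divide_distrib)
  ultimately show ?thesis using max[of "(s + t) / 2"] by (simp add: field_simps)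
qed

text \<open>If the maximizers for two totals were in the wrong order, swapping them would not lower the
  combined value, by concavity of \<open>r\<close>; this contradicts their uniqueness.\<close>

lemma convolution_maximizer_mono:
  fixes r \<phi> s :: "real \<Rightarrow> real"
  assumes r: "concave_on UNIV r"
    and max: "\<And>y t. t \<noteq> s y \<Longrightarrow> r (y - t) + \<phi> t < r (y - s y) + \<phi> (s y)"
  shows "mono s"
proof (rule monoI, rule ccontr)
  fix y y' :: real
  assume "y \<le> y'" and "\<not> s y \<le> s y'"
  then have "r (y - s y) + r (y' - s y') \<le> r (y - s y') + r (y' - s y)"
    by (intro concave_exchange[OF r]) auto
  moreover have "r (y - s y') + \<phi> (s y') < r (y - s y) + \<phi> (s y)"
    "r (y' - s y) + \<phi> (s y) < r (y' - s y') + \<phi> (s y')"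
    using \<open>\<not> s y \<le> s y'\<close> by (auto intro!: max)
  ultimately show False by linarith
qed

text \<open>The sup-convolution is symmetric in its two functions, so the complementary part
  \<open>y - s y\<close> is the maximizer with their roles exchanged.\<close>

lemma convolution_complement_mono:
  fixes r \<phi> s :: "real \<Rightarrow> real"
  assumes \<phi>: "concave_on UNIV \<phi>"
    and max: "\<And>y t. t \<noteq> s y \<Longrightarrow> r (y - t) + \<phi> t < r (y - s y) + \<phi> (s y)"
  shows "mono (\<lambda>y. y - s y)"
proof (rule convolution_maximizer_mono[OF \<phi>, where \<phi> = r])
  fix y t :: real
  assume "t \<noteq> y - s y"
  then show "\<phi> (y - t) + r t < \<phi> (y - (y - s y)) + r (y - s y)"
    using max[of "y - t" y] by force
qed

lemma convolution_concave:
  fixes r \<phi> s :: "real \<Rightarrow> real"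
  assumes r: "concave_on UNIV r" and \<phi>: "concave_on UNIV \<phi>"
    and max: "\<And>y t. r (y - t) + \<phi> t \<le> r (y - s y) + \<phi> (s y)"
  shows "concave_on UNIV (\<lambda>y. r (y - s y) + \<phi> (s y))"
  unfolding concave_on_def
proof (rule convex_onI)
  fix t y y' :: real
  assume t: "0 < t" "t < 1"
  define w where "w = (1 - t) * s y + t * s y'"
  have "(1 - t) * (y - s y) + t * (y' - s y') = (1 - t) * y + t * y' - w"
    by (simp add: w_def algebra_simps)
  then have "(1 - t) * r (y - s y) + t * r (y' - s y') \<le> r ((1 - t) * y + t * y' - w)"
    using concave_onD_real[OF r, of t "y - s y" "y' - s y'"] t by simp
  moreover have "(1 - t) * \<phi> (s y) + t * \<phi> (s y') \<le> \<phi> w"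
    using concave_onD_real[OF \<phi>, of t "s y" "s y'"] t by (simp add: w_def)
  ultimately have "(1 - t) * (r (y - s y) + \<phi> (s y)) + t * (r (y' - s y') + \<phi> (s y'))
      \<le> r ((1 - t) * y + t * y' - w) + \<phi> w"
    by (simp add: algebra_simps)
  also note max
  finally show "- (r ((1 - t) *\<^sub>R y + t *\<^sub>R y' - s ((1 - t) *\<^sub>R y + t *\<^sub>R y'))
        + \<phi> (s ((1 - t) *\<^sub>R y + t *\<^sub>R y')))
      \<le> (1 - t) * - (r (y - s y) + \<phi> (s y)) + t * - (r (y' - s y') + \<phi> (s y'))"
    by (simp add: algebra_simps)
qed simp

section \<open>Touching sets of attained envelopes\<close>

text \<open>A concave function \<open>G\<close> that dominates \<open>g\<close> along \<open>f\<close> and is attained in every fibre of \<open>f\<close>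
  lies below every other concave majorant, so \<open>G \<circ> f\<close> is the envelope. Envelopes agree on
  \<open>\<Gamma>\<close>, so any other witness for touching may be replaced by this one.\<close>

lemma touching_set_of_attained_envelope:
  assumes G: "concave_on UNIV G" and dom: "\<And>a. a \<in> \<Gamma> \<Longrightarrow> g a \<le> G (f a)"
    and x: "\<And>y. x y \<in> \<Gamma>" "\<And>y. f (x y) = y" "\<And>y. g (x y) = G y" and "\<Gamma> \<subseteq> D"
  shows "touching_set D f \<Gamma> g = {a \<in> \<Gamma>. g a = G (f a)}"
proof -
  have env: "is_f_concave_envelope D f \<Gamma> g (\<lambda>a. G (f a))"
    unfolding is_f_concave_envelope_def
  proof (intro conjI allI impI ballI)
    show "f_concave D f (\<lambda>a. G (f a))" unfolding f_concave_def using G by blast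
    fix h' a
    assume "f_concave D f h' \<and> (\<forall>x\<in>\<Gamma>. g x \<le> h' x)" and a: "a \<in> \<Gamma>"
    then obtain \<phi> where \<phi>: "\<And>x. x \<in> D \<Longrightarrow> h' x = \<phi> (f x)" and le: "\<And>x. x \<in> \<Gamma> \<Longrightarrow> g x \<le> h' x"
      unfolding f_concave_def by blast
    have "g (x (f a)) \<le> h' (x (f a))" using le x by blast
    then show "G (f a) \<le> h' a" using \<phi> x a \<open>\<Gamma> \<subseteq> D\<close> by (metis subsetD)
  qed (use dom in auto)
  have agree: "h a = G (f a)" if "is_f_concave_envelope D f \<Gamma> g h" "a \<in> \<Gamma>" for h a
    using that env unfolding is_f_concave_envelope_def by (meson order_antisym)
  have "(\<exists>h. is_f_concave_envelope D f \<Gamma> g h \<and> g a = h a) \<longleftrightarrow> g a = G (f a)" if "a \<in> \<Gamma>" for a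
    using agree[OF _ that] exI[of _ "\<lambda>a. G (f a)"] env by metis
  then show ?thesis unfolding touching_set_def by (intro Collect_cong conj_cong refl)
qed

section \<open>Parameterization by total effort\<close>

definition total_effort_parameterization ::
  "(nat \<Rightarrow> real \<Rightarrow> real) \<Rightarrow> (nat \<Rightarrow> real) \<Rightarrow> nat \<Rightarrow> nat \<Rightarrow> (real \<Rightarrow> nat \<Rightarrow> real) \<Rightarrow> bool" where
  "total_effort_parameterization r \<beta> N k x \<longleftrightarrow>
     Gam r \<beta> N k = range x \<and>
     (\<forall>y. x y \<in> effort_space k N \<and> (\<Sum>j=k..N. x y j) = y) \<and>
     (\<forall>j\<in>{k..N}. mono (\<lambda>y. x y j)) \<and>
     concave_on UNIV (\<lambda>y. mu r \<beta> N k (x y))"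

lemma mu_unfold_first:
  assumes "k < N"
  shows "mu r \<beta> N k a = r k (a k) + \<beta> k * mu r \<beta> N (Suc k) (restrict a {Suc k..N})"
proof -
  have "mu r \<beta> N k a = gamma_coeff \<beta> k k * r k (a k) + (\<Sum>j=Suc k..N. gamma_coeff \<beta> k j * r j (a j))"
    unfolding mu_def using assms by (intro sum.atLeast_Suc_atMost) auto
  also have "(\<Sum>j=Suc k..N. gamma_coeff \<beta> k j * r j (a j)) =
      (\<Sum>j=Suc k..N. \<beta> k * (gamma_coeff \<beta> (Suc k) j * r j (restrict a {Suc k..N} j)))"
    by (intro sum.cong) (auto simp: gamma_coeff_def prod.atLeast_Suc_lessThan)
  finally show ?thesis by (simp add: mu_def gamma_coeff_def sum_distrib_left)
qed

text \<open>At the last stage the envelope of \<open>r\<^sup>N\<close> is \<open>r\<^sup>N\<close> itself, touched everywhere.\<close>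

lemma total_effort_parameterization_last:
  assumes "concave_on UNIV (r N)"
  shows "total_effort_parameterization r \<beta> N N (\<lambda>y. \<lambda>j\<in>{N..N}. y)"
proof -
  have env: "is_concave_envelope (r N) (r N)"
    unfolding is_concave_envelope_def using assms by auto
  have "Gam r \<beta> N N = effort_space N N"
    by (subst Gam.simps) (use env in auto)
  also have "\<dots> = range (\<lambda>y. \<lambda>j\<in>{N..N}. y)"
  proof (intro equalityI subsetI)
    fix a :: "nat \<Rightarrow> real"
    assume "a \<in> effort_space N N"
    then have "a = (\<lambda>j\<in>{N..N}. a N)" by (auto simp: PiE_def extensional_def fun_eq_iff)
    then show "a \<in> range (\<lambda>y. \<lambda>j\<in>{N..N}. y)" by (rule range_eqI)
  qed (auto split: if_splits)
  finally show ?thesis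
    unfolding total_effort_parameterization_def
    using assms by (auto simp: mu_def gamma_coeff_def mono_def)
qed

text \<open>The parameterization \<open>x\<close> of \<open>\<Gamma>\<^sub>k\<^sub>+\<^sub>1\<close> reduces the envelope to a sup-convolution on the line,
  and the point of \<open>\<Gamma>\<^sub>k\<close> that nonemptiness provides yields the two parallel supporting lines
  which make that convolution attained.\<close>

lemma total_effort_parameterization_step:
  assumes k: "k < N" and r: "strictly_concave (r k)" and \<beta>: "\<beta> k \<ge> 0"
    and param: "total_effort_parameterization r \<beta> N (Suc k) x"
    and nonempty: "Gam r \<beta> N k \<noteq> {}"
  shows "\<exists>x'. total_effort_parameterization r \<beta> N k x'"
proof -
  define \<phi> where "\<phi> s = \<beta> k * mu r \<beta> N (Suc k) (x s)" for s
  have Gam_next: "Gam r \<beta> N (Suc k) = range x"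
    and x_space: "\<And>y. x y \<in> effort_space (Suc k) N"
    and x_sum: "\<And>y. (\<Sum>j=Suc k..N. x y j) = y"
    and x_mono: "\<And>j. j \<in> {Suc k..N} \<Longrightarrow> mono (\<lambda>y. x y j)"
    and x_concave: "concave_on UNIV (\<lambda>y. mu r \<beta> N (Suc k) (x y))"
    using param unfolding total_effort_parameterization_def by auto
  have \<phi>: "concave_on UNIV \<phi>"
    using convex_on_cmul[OF \<beta>] x_concave unfolding \<phi>_def concave_on_def by fastforce
  have r_conc: "concave_on UNIV (r k)" using r by (rule strictly_concave_imp_concave_on)
  define D where "D = effort_space k N"
  define f :: "(nat \<Rightarrow> real) \<Rightarrow> real" where "f a = (\<Sum>j=k..N. a j)" for a
  define \<Gamma> where "\<Gamma> = {a \<in> D. restrict a {Suc k..N} \<in> Gam r \<beta> N (Suc k)}"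
  define g where "g = mu r \<beta> N k"
  have Gam_k: "Gam r \<beta> N k = touching_set D f \<Gamma> g"
    unfolding D_def f_def \<Gamma>_def g_def by (subst Gam.simps) (use k in simp)
  \<comment> \<open>The coordinates \<open>(a, s)\<close> on \<open>\<real> \<times> \<Gamma>\<^sub>k\<^sub>+\<^sub>1\<close>.\<close>
  define pt where "pt a s = (x s)(k := a)" for a s
  have range_k: "{k..N} = insert k {Suc k..N}" using k by auto
  have pt_restrict: "restrict (pt a s) {Suc k..N} = x s" for a s
    using x_space[of s] by (auto simp: pt_def PiE_def extensional_def fun_eq_iff)
  have pt_D: "pt a s \<in> D" for a s
    unfolding D_def range_k pt_def by (intro PiE_fun_upd x_space) auto
  have pt_\<Gamma>: "pt a s \<in> \<Gamma>" for a s
    unfolding \<Gamma>_def using pt_D pt_restrict Gam_next by auto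
  have \<Gamma>_pt: "\<exists>a s. b = pt a s" if "b \<in> \<Gamma>" for b
  proof -
    from that Gam_next obtain s where s: "restrict b {Suc k..N} = x s" and b: "b \<in> D"
      by (auto simp: \<Gamma>_def)
    have "b j = pt (b k) s j" for j
      using fun_cong[OF s, of j] b x_space[of s]
      by (cases "j \<in> {Suc k..N}") (auto simp: pt_def D_def PiE_def extensional_def)
    then show ?thesis by blast
  qed
  have f_pt: "f (pt a s) = a + s" for a s
  proof -
    have "f (pt a s) = a + (\<Sum>j=Suc k..N. pt a s j)"
      unfolding f_def range_k by (simp add: pt_def)
    also have "(\<Sum>j=Suc k..N. pt a s j) = (\<Sum>j=Suc k..N. x s j)"
      by (intro sum.cong) (auto simp: pt_def)
    finally show ?thesis by (simp add: x_sum)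
  qed
  have g_pt: "g (pt a s) = r k a + \<phi> s" for a s
    unfolding g_def \<phi>_def by (subst mu_unfold_first[OF k]) (simp add: pt_restrict, simp add: pt_def)
  \<comment> \<open>A supporting line at a touching point, split by moving one coordinate at a time.\<close>
  from nonempty obtain b h where "b \<in> \<Gamma>" and h: "is_f_concave_envelope D f \<Gamma> g h" "g b = h b"
    unfolding Gam_k touching_set_def by auto
  then obtain a0 s0 where b: "b = pt a0 s0" using \<Gamma>_pt by blast
  from h(1) obtain H where H: "concave_on UNIV H" "\<And>a. a \<in> D \<Longrightarrow> h a = H (f a)"
    unfolding is_f_concave_envelope_def f_concave_def by auto
  obtain p where p: "\<And>y. H y \<le> H (a0 + s0) + p * (y - (a0 + s0))"
    using concave_supporting_line[OF H(1)] by blast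
  have "g (pt a s) \<le> h (pt a s)" for a s
    using h(1) pt_\<Gamma> unfolding is_f_concave_envelope_def by blast
  then have "r k a + \<phi> s \<le> H (a + s)" for a s
    by (metis H(2) pt_D f_pt g_pt)
  moreover have "r k a0 + \<phi> s0 = H (a0 + s0)"
    using h(2) H(2) pt_D f_pt g_pt b by metis
  ultimately have line: "r k a + \<phi> s \<le> r k a0 + \<phi> s0 + p * (a + s - (a0 + s0))" for a s
    using p[of "a + s"] by (metis order_trans)
  have line_r: "r k a \<le> r k a0 + p * (a - a0)" for a using line[of a s0] by simp
  have line_\<phi>: "\<phi> s \<le> \<phi> s0 + p * (s - s0)" for s using line[of a0 s] by simp
  obtain s where s: "\<And>y t. r k (y - t) + \<phi> t \<le> r k (y - s y) + \<phi> (s y)"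
    using convolution_attained[OF r \<phi> line_r line_\<phi>] by metis
  have s_strict: "r k (y - t) + \<phi> t < r k (y - s y) + \<phi> (s y)" if "t \<noteq> s y" for y t
    using convolution_maximizer_unique[OF r \<phi> s that] .
  define G where "G y = r k (y - s y) + \<phi> (s y)" for y
  have G: "concave_on UNIV G"
    unfolding G_def using convolution_concave[OF r_conc \<phi> s] .
  define x' where "x' y = pt (y - s y) (s y)" for y
  have f_x': "f (x' y) = y" and g_x': "g (x' y) = G y" for y
    by (simp_all add: x'_def f_pt g_pt G_def)
  have dom: "g a \<le> G (f a)" if a: "a \<in> \<Gamma>" for a
  proof -
    obtain u v where "a = pt u v" using \<Gamma>_pt[OF a] by blast
    then show ?thesis using s[of "u + v" v] by (simp add: f_pt g_pt G_def)
  qed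
  have touch: "touching_set D f \<Gamma> g = {a \<in> \<Gamma>. g a = G (f a)}"
    by (intro touching_set_of_attained_envelope[where x = x'] G dom f_x' g_x')
      (auto simp: x'_def pt_\<Gamma>, auto simp: \<Gamma>_def)
  also have "\<dots> = range x'"
  proof (intro equalityI subsetI)
    fix a
    assume "a \<in> {a \<in> \<Gamma>. g a = G (f a)}"
    then obtain u v where a: "a = pt u v" and eq: "r k u + \<phi> v = G (u + v)"
      using \<Gamma>_pt by (force simp: f_pt g_pt)
    then have "v = s (u + v)" using s_strict[of v "u + v"] by (fastforce simp: G_def)
    then have "a = x' (u + v)" unfolding x'_def a by (metis add_diff_cancel_right')
    then show "a \<in> range x'" by blast
  qed (auto simp: f_x' g_x', auto simp: x'_def pt_\<Gamma>)
  finally have "Gam r \<beta> N k = range x'" unfolding Gam_k .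
  moreover have "mono (\<lambda>y. x' y j)" if "j \<in> {k..N}" for j
  proof (cases "j = k")
    case True
    then show ?thesis
      using convolution_complement_mono[OF \<phi> s_strict] by (simp add: x'_def pt_def)
  next
    case False
    then have "mono (\<lambda>y. x y j)" using that by (intro x_mono) auto
    then show ?thesis
      using False convolution_maximizer_mono[OF r_conc s_strict]
      by (auto simp: x'_def pt_def mono_def)
  qed
  ultimately have "total_effort_parameterization r \<beta> N k x'"
    unfolding total_effort_parameterization_def
    using pt_D f_x' G g_x' by (auto simp: x'_def D_def f_def g_def)
  then show ?thesis by blast
qed

text \<open>Emptiness propagates from \<open>\<Gamma>\<^sub>k\<^sub>+\<^sub>1\<close> to \<open>\<Gamma>\<^sub>k\<close>, so a nonempty \<open>\<Gamma>\<^sub>k\<close> guarantees the touching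
  points that all the earlier stages of the recursion need.\<close>

lemma total_effort_parameterization_exists:
  assumes "k \<le> N"
    and "\<And>j. j \<in> {k..N} \<Longrightarrow> strictly_concave (r j)"
    and "\<And>j. j \<in> {k..<N} \<Longrightarrow> \<beta> j \<ge> 0"
    and "Gam r \<beta> N k \<noteq> {}"
  shows "\<exists>x. total_effort_parameterization r \<beta> N k x"
  using assms
proof (induction k rule: inc_induct)
  case base
  have "strictly_concave (r N)" by (rule base.prems(1)) simp
  then have r: "concave_on UNIV (r N)" by (rule strictly_concave_imp_concave_on)
  show ?case by (rule exI, rule total_effort_parameterization_last, rule r)
next
  case (step k)
  have "Gam r \<beta> N k = {}" if "Gam r \<beta> N (Suc k) = {}"
    using that step.hyps by (simp add: Gam.simps[of r \<beta> N k] touching_set_def)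
  then have "Gam r \<beta> N (Suc k) \<noteq> {}"
    using step.prems(3) by blast
  then have "\<exists>x. total_effort_parameterization r \<beta> N (Suc k) x"
    by (intro step.IH step.prems) (simp_all add: Suc_le_eq)
  then obtain x where x: "total_effort_parameterization r \<beta> N (Suc k) x" ..
  have "strictly_concave (r k)" by (rule step.prems(1)) (use step.hyps in simp)
  moreover have "\<beta> k \<ge> 0" by (rule step.prems(2)) (use step.hyps in simp)
  ultimately show ?case
    by (rule total_effort_parameterization_step[OF \<open>k < N\<close> _ _ x step.prems(3)])
qed

section \<open>Monotone parameterizations are homeomorphisms\<close>

text \<open>All components grow with \<open>y\<close> and together grow exactly as fast as \<open>y\<close>, so none of them
  can grow faster.\<close>

lemma mono_component_lipschitz:
  fixes x :: "real \<Rightarrow> 'i \<Rightarrow> real"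
  assumes "finite I" and sum: "\<And>y. (\<Sum>i\<in>I. x y i) = y"
    and mono: "\<And>i. i \<in> I \<Longrightarrow> mono (\<lambda>y. x y i)" and "j \<in> I"
  shows "1-lipschitz_on UNIV (\<lambda>y. x y j)"
proof -
  have up: "\<bar>x z j - x y j\<bar> \<le> z - y" if "y \<le> z" for y z
  proof -
    have nonneg: "0 \<le> x z i - x y i" if "i \<in> I" for i
      using mono[OF that] \<open>y \<le> z\<close> by (auto simp: mono_def)
    have "x z j - x y j \<le> (\<Sum>i\<in>I. x z i - x y i)"
      using assms nonneg by (intro member_le_sum) auto
    also have "\<dots> = z - y" by (simp add: sum_subtractf sum)
    finally show ?thesis using nonneg[OF \<open>j \<in> I\<close>] by simp
  qed
  show ?thesis
  proof (rule lipschitz_onI)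
    fix y z :: real
    show "dist (x y j) (x z j) \<le> 1 * dist y z"
      using up[of y z] up[of z y] by (cases "y \<le> z") (auto simp: dist_real_def)
  qed simp
qed

lemma homeomorphic_map_of_mono_components:
  fixes x :: "real \<Rightarrow> 'i \<Rightarrow> real"
  assumes I: "finite I" and space: "\<And>y. x y \<in> PiE I (\<lambda>_. UNIV)"
    and sum: "\<And>y. (\<Sum>i\<in>I. x y i) = y"
    and mono: "\<And>i. i \<in> I \<Longrightarrow> mono (\<lambda>y. x y i)"
  shows "homeomorphic_map euclideanreal (subtopology (powertop_real I) (range x)) x"
proof -
  have "continuous_map euclideanreal euclideanreal (\<lambda>y. x y i)" if "i \<in> I" for i
    using lipschitz_on_continuous_on[OF mono_component_lipschitz[OF I sum mono that]] by simp
  then have cont: "continuous_map euclideanreal (powertop_real I) x"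
    using space by (auto simp: continuous_map_componentwise PiE_def)
  have "continuous_map (subtopology (powertop_real I) (range x)) euclideanreal (\<lambda>a. \<Sum>i\<in>I. a i)"
    by (intro continuous_map_from_subtopology continuous_map_sum I
        continuous_map_product_projection)
  moreover have "continuous_map euclideanreal (subtopology (powertop_real I) (range x)) x"
    by (rule continuous_map_into_subtopology[OF cont]) simp
  moreover have "x (\<Sum>i\<in>I. a i) = a" if "a \<in> range x" for a
    using that sum by auto
  ultimately have "homeomorphic_maps euclideanreal (subtopology (powertop_real I) (range x)) x
      (\<lambda>a. \<Sum>i\<in>I. a i)"
    unfolding homeomorphic_maps_def by (simp add: sum)
  then show ?thesis unfolding homeomorphic_map_maps by blast
qed

theorem theorem4:
  fixes N :: nat and r :: "nat \<Rightarrow> real \<Rightarrow> real" and \<beta> :: "nat \<Rightarrow> real"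
  assumes "N \<ge> 1"
    and "\<And>k. k \<in> {1..N} \<Longrightarrow> strictly_concave (r k)"
    and "\<And>k. k \<in> {1..<N} \<Longrightarrow> \<beta> k \<ge> 0"
    and "Gam r \<beta> N 1 \<noteq> {}"
  shows "\<exists>\<psi>\<^sub>1. homeomorphic_map euclideanreal
                (subtopology (powertop_real {1..N}) (Gam r \<beta> N 1)) \<psi>\<^sub>1"
proof -
  obtain x where x: "total_effort_parameterization r \<beta> N 1 x"
    using total_effort_parameterization_exists[OF assms] by blast
  then have "homeomorphic_map euclideanreal (subtopology (powertop_real {1..N}) (range x)) x"
    unfolding total_effort_parameterization_def
    by (intro homeomorphic_map_of_mono_components) auto
  with x show ?thesis unfolding total_effort_parameterization_def by auto
qed

end
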